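(* Let $q$ be an odd prime power, let $f(X)=X^2+bX+c$ be a quadratic polynomial over $\mathbb F_q$ with $c\neq 0$, and let $\theta_1$ and $\theta_2$ be the two roots of $f(X)$ (in an algebraic closure of $\mathbb F_q$). Then for any positive integer $n$ that is coprime to $q$, $\Lambda_n(b,c)=0$ if and only if $\operatorname{ord}\left(\frac{\theta_1}{\theta_2}\right)=n$.
   Context: $\operatorname{ord}$ denotes multiplicative order. Lucas atoms: let $B,C$ be algebraically independent indeterminates over $\mathbb F_q$, and let $\alpha,\beta$ be the two roots of $T^2+BT+C$ in an algebraic closure of $\mathbb F_q(B,C)$. Let $\Phi_n(X)$ be the $n$-th cyclotomic polynomial over $\mathbb F_q$, $\varphi$ Euler's totient function, and $\Phi_n^{\mathrm{hom}}(\alpha,\beta)=\beta^{\varphi(n)}\Phi_n(\alpha/\beta)$. The $n$-th Lucas atom $\Lambda_n(B,C)\in\mathbb F_q[B,C]$ is defined by $\Lambda_1(B,C)=1$ for $n=1$, and for $n\ge 2$ as the unique polynomial with $\Lambda_n(B,C)=\Phi_n^{\mathrm{hom}}(\alpha,\beta)$.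
   Formalization: For n = 1 the two roots θ₁, θ₂ are assumed distinct, because with a double root ord(θ₁/θ₂) = 1 = n while Λ₁ = 1 ≠ 0 (e.g. q = 3, f = X²+X+1 = (X−1)²); for n ≥ 2 double roots are allowed. *)

theory Defs
  imports
    Complex_Main
    "HOL-Library.Cardinality"
    "HOL-Computational_Algebra.Computational_Algebra"
    "HOL-Number_Theory.Totient"
    "HOL-Algebra.Multiplicative_Group"
    "HOL-Algebra.Algebraic_Closure_Type"
begin

text \<open>
  The cyclotomic polynomial over a ring is the image of the one over the integers, which is
  the product of \<open>X - \<zeta>\<close> over the primitive complex \<open>n\<close>-th roots of unity \<open>\<zeta>\<close>. This covers every
  \<open>n > 0\<close>, including multiples of the characteristic, and over a field whose
  characteristic does not divide \<open>n\<close> it agrees with the product over the primitive \<open>n\<close>-th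
  roots of unity in an algebraic closure.
\<close>

definition cyclotomic_int :: "nat \<Rightarrow> int poly" where
  "cyclotomic_int n = (THE P. map_poly of_int P =
     (\<Prod>k\<in>totatives n. [:- cis (2 * pi * real k / real n), 1:]))"

definition cyclotomic :: "nat \<Rightarrow> 'a :: comm_ring_1 poly" where
  "cyclotomic n = map_poly of_int (cyclotomic_int n)"

text \<open>
  A polynomial in two indeterminates \<open>B, C\<close> is an element of \<^typ>\<open>'a poly poly\<close>; \<open>B\<close> is the inner
  and \<open>C\<close> the outer variable.
\<close>

definition indet_B :: "'a :: field poly poly" where
  "indet_B = [:[:0, 1:]:]"

definition indet_C :: "'a :: field poly poly" where
  "indet_C = [:0, 1:]"

definition eval_BC :: "'a :: field poly poly \<Rightarrow> 'a \<Rightarrow> 'a \<Rightarrow> 'a" where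
  "eval_BC P b c = poly (poly P [:c:]) b"

definition BC_to_ac :: "'a :: field poly poly \<Rightarrow> 'a poly poly fract alg_closure" where
  "BC_to_ac P = to_ac (to_fract P)"

definition cyclotomic_hom ::
  "nat \<Rightarrow> 'a :: field poly poly fract alg_closure \<Rightarrow> 'a poly poly fract alg_closure
     \<Rightarrow> 'a poly poly fract alg_closure" where
  "cyclotomic_hom n \<alpha> \<beta> =
     \<beta> ^ totient n *
     poly (map_poly (\<lambda>a. BC_to_ac [:[:a:]:]) (cyclotomic n :: 'a poly)) (\<alpha> / \<beta>)"

text \<open>
  The two roots \<open>\<alpha>, \<beta>\<close>, counted with multiplicity, are given by the factorisation of
  \<open>T\<^sup>2 + B T + C\<close>; the value does not depend on their order.
  For \<open>n = 1\<close>, where \<open>\<alpha> - \<beta>\<close> is not symmetric, the atom is the constant 1 by convention.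
\<close>

definition lucas_atom :: "nat \<Rightarrow> 'a :: field poly poly" where
  "lucas_atom n = (if n = 1 then 1 else
     (THE L. \<forall>\<alpha> \<beta>. [:BC_to_ac indet_C, BC_to_ac indet_B, 1:] = [:-\<alpha>, 1:] * [:-\<beta>, 1:] \<longrightarrow>
        BC_to_ac L = cyclotomic_hom n \<alpha> \<beta>))"

definition mult_ord :: "'a :: field \<Rightarrow> nat" where
  "mult_ord x = group.ord (mult_of ring_of_type_algebra) x"

end

theory Submission
  imports Defs "HOL-Number_Theory.Residues"
begin

text \<open>
  Over \<open>\<int>\<close> the product of \<open>\<Phi>\<^sub>d\<close> over \<open>d dvd n\<close> is \<open>X^n - 1\<close>, so this holds over every field. Hence
  \<open>x\<close> is an \<open>n\<close>-th root of unity iff \<open>\<Phi>\<^sub>d(x) = 0\<close> for some \<open>d dvd n\<close>, and since \<open>X^n - 1\<close> is squarefree for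
  \<open>n\<close> prime to the characteristic, \<open>\<Phi>\<^sub>n(x) = 0\<close> iff \<open>x\<close> has order \<open>n\<close>. The atom is connected to
  \<open>\<Phi>\<^sub>n\<close> by palindromicity: \<open>\<Phi>\<^sub>n\<^sup>h\<^sup>o\<^sup>m(x, y)\<close> is half the sum of
  \<open>a\<^sub>i (x^i y^(m-i) + x^(m-i) y^i)\<close> with \<open>m = \<phi>(n)\<close>, and each summand is a fixed polynomial in
  \<open>-(x + y)\<close> and \<open>x y\<close>. Substituting for these \<open>B, C\<close> or \<open>b, c\<close> gives
  \<open>\<Lambda>\<^sub>n(b, c) = \<theta>\<^sub>2^m \<Phi>\<^sub>n(\<theta>\<^sub>1/\<theta>\<^sub>2)\<close> for \<open>n \<ge> 2\<close>.
\<close>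

section \<open>Cyclotomic polynomials\<close>

lemma map_poly_mult_hom:
  assumes "f 0 = 0" "\<And>a b. f (a + b) = f a + f b" "\<And>a b. f (a * b) = f a * f b"
  shows "map_poly f (p * q) = map_poly f p * map_poly f q"
proof (rule poly_eqI)
  have sum: "f (sum g A) = (\<Sum>x\<in>A. f (g x))" for g and A :: "nat set"
    by (induction A rule: infinite_finite_induct) (use assms in auto)
  show "coeff (map_poly f (p * q)) n = coeff (map_poly f p * map_poly f q) n" for n
    using assms by (simp add: coeff_map_poly coeff_mult sum)
qed

lemma map_poly_of_int_mult:
  "map_poly of_int (p * q) = map_poly of_int p * (map_poly of_int q :: 'a::comm_ring_1 poly)"
  by (rule map_poly_mult_hom) auto

lemma map_poly_of_int_add:
  "map_poly of_int (p + q) = map_poly of_int p + (map_poly of_int q :: 'a::comm_ring_1 poly)"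
  by (rule poly_eqI) (simp add: coeff_map_poly)

lemma map_poly_of_int_prod:
  "map_poly of_int (prod f A) = (\<Prod>x\<in>A. map_poly of_int (f x) :: 'a::comm_ring_1 poly)"
  by (induction A rule: infinite_finite_induct) (auto simp: map_poly_of_int_mult)

lemma map_poly_of_int_monom_minus_1:
  "map_poly of_int (monom 1 n - 1) = (monom 1 n - 1 :: 'a::comm_ring_1 poly)"
  by (rule poly_eqI) (auto simp: coeff_map_poly coeff_1)

lemma inj_map_poly_of_int: "inj (map_poly of_int :: int poly \<Rightarrow> complex poly)"
  by (rule injI, rule poly_eqI) (metis coeff_map_poly of_int_0 of_int_eq_iff)

lemma degree_map_poly_of_int:
  "degree (map_poly of_int p :: complex poly) = degree p"
  by (rule degree_map_poly) auto

text \<open>Division with remainder by a monic \<open>G\<close> stays within integer polynomials.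
  Over the complex numbers the remainder equals \<open>G\<close> times the difference of the two
  quotients, so by degree this difference vanishes.\<close>

lemma monic_int_poly_quotient:
  fixes F G :: "int poly" and Q :: "complex poly"
  assumes "lead_coeff G = 1" "map_poly of_int F = map_poly of_int G * Q"
  shows "\<exists>P. map_poly of_int P = Q"
proof -
  obtain P r where Pr: "pseudo_divmod F G = (P, r)"
    by fastforce
  have "G \<noteq> 0"
    using assms by auto
  note * = pseudo_divmod[OF this Pr]
  let ?h = "map_poly of_int :: int poly \<Rightarrow> complex poly"
  \<comment> \<open>Pseudo-division multiplies \<open>F\<close> by a power of the leading
    coefficient of \<open>G\<close>, which is 1 here.\<close>
  have "F = G * P + r"
    using *(1) assms(1) by simp
  hence "?h F = ?h G * ?h P + ?h r"
    by (simp add: map_poly_of_int_add map_poly_of_int_mult)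
  hence eq: "?h r = ?h G * (Q - ?h P)"
    using assms by (simp add: algebra_simps)
  have "Q - ?h P = 0"
  proof (rule ccontr)
    assume nz: "Q - ?h P \<noteq> 0"
    have G: "?h G \<noteq> 0"
      using \<open>G \<noteq> 0\<close> inj_map_poly_of_int by (metis injD map_poly_0)
    have "degree r = degree G + degree (Q - ?h P)"
      using eq nz G by (metis degree_map_poly_of_int degree_mult_eq)
    moreover have "r \<noteq> 0"
      using eq nz G by auto
    ultimately show False
      using *(2) by auto
  qed
  thus ?thesis by auto
qed

section \<open>Factorisation of X^n - 1 over the complex numbers\<close>

text \<open>Each fraction j/n with 1 \<le> j \<le> n has exactly one reduced form k/d, and d divides
  n. The two witnesses are reduction to lowest terms and expansion to denominator n.\<close>

lemma prod_totatives_divisors: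
  fixes f :: "real \<Rightarrow> 'a::comm_monoid_mult"
  assumes "n > 0"
  shows "(\<Prod>d | d dvd n. \<Prod>k\<in>totatives d. f (real k / real d)) = (\<Prod>k=1..n. f (real k / real n))"
proof -
  have "(\<Prod>d | d dvd n. \<Prod>k\<in>totatives d. f (real k / real d)) =
        (\<Prod>(d, k)\<in>Sigma {d. d dvd n} totatives. f (real k / real d))"
    by (rule prod.Sigma) (use assms in auto)
  also have "\<dots> = (\<Prod>k=1..n. f (real k / real n))"
  proof (rule prod.reindex_bij_witness
      [where i = "\<lambda>j. (n div gcd j n, j div gcd j n)" and j = "\<lambda>(d, k). k * (n div d)"])
    fix x assume "x \<in> Sigma {d. d dvd n} totatives"
    then obtain d k e where x: "x = (d, k)" "n = d * e" "k > 0" "k \<le> d" "coprime k d"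
      by (auto simp: in_totatives_iff elim!: dvdE)
    have pos: "d > 0" "e > 0"
      using x assms by auto
    have g: "gcd (k * e) (d * e) = e"
      using x(5) by (metis coprime_imp_gcd_eq_1 gcd_mult_distrib_nat mult.commute mult_1)
    show "(n div gcd ((\<lambda>(d, k). k * (n div d)) x) n,
           (\<lambda>(d, k). k * (n div d)) x div gcd ((\<lambda>(d, k). k * (n div d)) x) n) = x"
      using x pos g by simp
    show "(\<lambda>(d, k). k * (n div d)) x \<in> {1..n}"
      using x pos by simp
    show "f (real ((\<lambda>(d, k). k * (n div d)) x) / real n) = (\<lambda>(d, k). f (real k / real d)) x"
      using x pos by simp
  next
    fix j assume j: "j \<in> {1..n}"
    let ?g = "gcd j n"
    have g: "?g > 0" using assms by simp
    obtain b where b: "n = ?g * b"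
      using gcd_dvd2[of j n] by (elim dvdE)
    hence "b > 0" using assms by (intro Nat.gr0I) simp
    have "n div (n div ?g) = ?g"
      using b g \<open>b > 0\<close> by (metis nonzero_mult_div_cancel_left nonzero_mult_div_cancel_right less_irrefl)
    hence "j div ?g * (n div (n div ?g)) = j" by simp
    thus "(\<lambda>(d, k). k * (n div d)) (n div ?g, j div ?g) = j" by simp
    have "coprime (j div ?g) (n div ?g)"
      using assms by (intro div_gcd_coprime) auto
    moreover have "j div ?g > 0"
      using j g by (auto simp: div_greater_zero_iff intro!: dvd_imp_le)
    ultimately show "(n div ?g, j div ?g) \<in> Sigma {d. d dvd n} totatives"
      using j by (auto simp: in_totatives_iff div_le_mono intro: div_dvd_iff_mult[THEN iffD2])
  qed
  finally show ?thesis .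
qed

lemma degree_monom_minus_1:
  "n > 0 \<Longrightarrow> degree (monom 1 n - 1 :: 'a::comm_ring_1 poly) = n"
  unfolding diff_conv_add_uminus by (subst degree_add_eq_left) (auto simp: degree_monom_eq)

lemma prod_roots_of_unity:
  assumes "n > 0"
  shows "(\<Prod>k=1..n. [:- cis (2 * pi * (real k / real n)), 1:]) = monom 1 n - 1"
proof -
  let ?p = "monom 1 n - 1 :: complex poly"
  let ?f = "\<lambda>k. [:- cis (2 * pi * (real k / real n)), 1:]"
  have deg: "degree ?p = n"
    using assms by (rule degree_monom_minus_1)
  have lc: "lead_coeff ?p = 1"
    unfolding deg using assms by (simp add: coeff_1)
  have sqf: "rsquarefree ?p"
    using assms by (auto simp: rsquarefree_roots poly_monom pderiv_diff pderiv_monom power_0_left)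
  have "?p = (\<Prod>z | z ^ n = 1. [:-z, 1:])"
    using complex_poly_decompose_rsquarefree[OF sqf] lc by (simp add: poly_monom)
  also have "\<dots> = (\<Prod>k<n. ?f k)"
    using prod.reindex_bij_betw[OF bij_betw_roots_unity[OF assms], of "\<lambda>z. [:-z, 1:]"] by simp
  also have "\<dots> = (\<Prod>k=1..n. ?f k)"
  \<comment> \<open>The library numbers the roots from 0 to n - 1, totatives lie in 1..n. The ends
    agree because \<open>cis 0\<close> and \<open>cis (2 * pi)\<close> are both 1.\<close>
  proof -
    obtain m where n: "n = Suc m"
      using assms by (cases n) auto
    have "(\<Prod>k<n. ?f k) = ?f 0 * (\<Prod>k<m. ?f (Suc k))"
      unfolding n by (rule prod.lessThan_Suc_shift)
    also have "?f 0 = ?f (Suc m)"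
      using n by simp
    finally show ?thesis
      unfolding n One_nat_def prod.atLeast1_atMost_eq prod.lessThan_Suc by (simp only: mult.commute)
  qed
  finally show ?thesis ..
qed

definition cyclotomic_complex :: "nat \<Rightarrow> complex poly" where
  "cyclotomic_complex n = (\<Prod>k\<in>totatives n. [:- cis (2 * pi * real k / real n), 1:])"

lemma prod_cyclotomic_complex:
  "n > 0 \<Longrightarrow> (\<Prod>d | d dvd n. cyclotomic_complex d) = monom 1 n - 1"
  using prod_totatives_divisors[of n "\<lambda>x. [:- cis (2 * pi * x), 1:]"] prod_roots_of_unity[of n]
  by (simp add: cyclotomic_complex_def)

lemma lead_coeff_cyclotomic_complex: "lead_coeff (cyclotomic_complex n) = 1"
  by (simp add: cyclotomic_complex_def lead_coeff_prod)

lemma degree_cyclotomic_complex: "degree (cyclotomic_complex n) = totient n"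
  unfolding cyclotomic_complex_def by (subst degree_prod_eq_sum_degree) (auto simp: totient_def)

section \<open>Descent to the integers\<close>

text \<open>By strong induction, the factors for proper divisors of n have integer coefficients.
  Their product is monic and the n-th factor is the quotient of X^n - 1 by it.\<close>

lemma cyclotomic_complex_integral:
  "n > 0 \<Longrightarrow> \<exists>P. map_poly of_int P = cyclotomic_complex n"
proof (induction n rule: less_induct)
  case (less n)
  define D where "D = {d. d dvd n} - {n}"
  have "\<exists>P. map_poly of_int P = cyclotomic_complex d" if "d \<in> D" for d
    using that less.prems less.IH[of d] by (auto simp: D_def dest: dvd_imp_le intro: Nat.gr0I)
  then obtain P where P: "\<And>d. d \<in> D \<Longrightarrow> map_poly of_int (P d) = cyclotomic_complex d"
    by metis
  have G: "map_poly of_int (prod P D) = (\<Prod>d\<in>D. cyclotomic_complex d)"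
    using P by (simp add: map_poly_of_int_prod)
  have "lead_coeff (map_poly of_int (prod P D) :: complex poly) = 1"
    unfolding G by (simp add: lead_coeff_prod lead_coeff_cyclotomic_complex)
  hence "lead_coeff (prod P D) = 1"
    by (simp add: degree_map_poly_of_int coeff_map_poly)
  moreover have "map_poly of_int (monom 1 n - 1) = map_poly of_int (prod P D) * cyclotomic_complex n"
    unfolding G map_poly_of_int_monom_minus_1 prod_cyclotomic_complex[OF less.prems, symmetric]
    unfolding D_def using less.prems by (subst prod.remove[of _ n]) (auto simp: mult.commute)
  ultimately show ?case
    by (rule monic_int_poly_quotient)
qed

text \<open>The description in \<open>cyclotomic_int\<close> is proper: integrality gives existence,
  injectivity of the coefficient embedding gives uniqueness.\<close>

lemma map_poly_cyclotomic_int: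
  assumes "n > 0"
  shows "map_poly of_int (cyclotomic_int n) = cyclotomic_complex n"
proof -
  obtain P where P: "map_poly of_int P = cyclotomic_complex n"
    using cyclotomic_complex_integral[OF assms] by blast
  show ?thesis
    unfolding cyclotomic_int_def cyclotomic_complex_def[symmetric]
    by (rule theI[of _ P], fact P) (metis P inj_map_poly_of_int injD)
qed

lemma degree_cyclotomic_int: "n > 0 \<Longrightarrow> degree (cyclotomic_int n) = totient n"
  by (metis map_poly_cyclotomic_int degree_cyclotomic_complex degree_map_poly_of_int)

lemma prod_cyclotomic_int:
  assumes "n > 0"
  shows "(\<Prod>d | d dvd n. cyclotomic_int d) = monom 1 n - 1"
proof -
  have "map_poly of_int (\<Prod>d | d dvd n. cyclotomic_int d) = (\<Prod>d | d dvd n. cyclotomic_complex d)"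
    unfolding map_poly_of_int_prod using assms
    by (intro prod.cong refl map_poly_cyclotomic_int) (auto intro: Nat.gr0I)
  also have "\<dots> = map_poly of_int (monom 1 n - 1)"
    using assms by (simp add: prod_cyclotomic_complex map_poly_of_int_monom_minus_1)
  finally show ?thesis
    using inj_map_poly_of_int by (auto dest: injD)
qed

section \<open>Palindromicity and transfer to arbitrary rings\<close>

lemma reflect_poly_monom_minus_1:
  assumes "n > 0"
  shows "reflect_poly (monom 1 n - 1) = - (monom 1 n - 1 :: int poly)"
proof (rule poly_eqI)
  have deg: "degree (monom 1 n - 1 :: int poly) = n"
    using assms by (rule degree_monom_minus_1)
  show "coeff (reflect_poly (monom 1 n - 1)) k = coeff (- (monom 1 n - 1 :: int poly)) k" for k
    using assms by (auto simp: coeff_reflect_poly deg coeff_1)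
qed

text \<open>Reflection is multiplicative and negates both X^n - 1 and the first cyclotomic
  polynomial X - 1. These signs cancel, the factors for divisors strictly between 1 and n are fixed
  by induction, so the n-th factor is fixed too.\<close>

lemma reflect_poly_cyclotomic_int:
  "n \<ge> 2 \<Longrightarrow> reflect_poly (cyclotomic_int n) = cyclotomic_int n"
proof (induction n rule: less_induct)
  case (less n)
  define R where "R = (\<Prod>d\<in>{d. d dvd n} - {1} - {n}. cyclotomic_int d)"
  have "n > 0" using less.prems by simp
  have "(\<Prod>d | d dvd n. cyclotomic_int d) = cyclotomic_int 1 * (cyclotomic_int n * R)"
    unfolding R_def using less.prems
    by (subst prod.remove[of _ 1], simp, simp, subst prod.remove[of _ n]) auto
  hence eq: "monom 1 n - 1 = cyclotomic_int 1 * (cyclotomic_int n * R)"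
    using prod_cyclotomic_int[OF \<open>n > 0\<close>] by simp
  have R: "reflect_poly R = R"
    unfolding R_def reflect_poly_prod
  proof (intro prod.cong refl less.IH)
    fix d assume "d \<in> {d. d dvd n} - {1} - {n}"
    hence "d dvd n" "d \<noteq> 0" "d \<noteq> 1" "d \<noteq> n"
      using \<open>n > 0\<close> by auto
    thus "d < n" "d \<ge> 2"
      using dvd_imp_le[of d n] \<open>n > 0\<close> by auto
  qed
  have c1: "cyclotomic_int 1 = monom 1 1 - 1"
    using prod_cyclotomic_int[of 1] by simp
  have "- (monom 1 n - 1) = - cyclotomic_int 1 * (reflect_poly (cyclotomic_int n) * R)"
    unfolding reflect_poly_monom_minus_1[OF \<open>n > 0\<close>, symmetric] unfolding eq reflect_poly_mult R
    unfolding c1 by (simp add: reflect_poly_monom_minus_1)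
  hence "cyclotomic_int 1 * (reflect_poly (cyclotomic_int n) * R) = cyclotomic_int 1 * (cyclotomic_int n * R)"
    unfolding eq by (simp only: mult_minus_left neg_equal_iff_equal)
  moreover have "monom 1 n - 1 \<noteq> (0 :: int poly)"
    using \<open>n > 0\<close> by (metis monom_eq_1_iff right_minus_eq less_numeral_extra(3))
  ultimately show ?case
    using eq by (metis mult_left_cancel mult_right_cancel mult_zero_left mult_zero_right)
qed

lemma degree_cyclotomic_le: "n > 0 \<Longrightarrow> degree (cyclotomic n :: 'a::comm_ring_1 poly) \<le> totient n"
  unfolding cyclotomic_def using map_poly_degree_leq degree_cyclotomic_int by metis

lemma coeff_cyclotomic_reflect:
  assumes "n \<ge> 2" "i \<le> totient n"
  shows "coeff (cyclotomic n :: 'a::comm_ring_1 poly) (totient n - i) = coeff (cyclotomic n) i"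
proof -
  have "coeff (reflect_poly (cyclotomic_int n)) i = coeff (cyclotomic_int n) (totient n - i)"
    using assms by (simp add: coeff_reflect_poly degree_cyclotomic_int)
  thus ?thesis
    using assms by (simp add: cyclotomic_def coeff_map_poly reflect_poly_cyclotomic_int)
qed

lemma prod_cyclotomic:
  "n > 0 \<Longrightarrow> (\<Prod>d | d dvd n. cyclotomic d) = (monom 1 n - 1 :: 'a::comm_ring_1 poly)"
  unfolding cyclotomic_def map_poly_of_int_prod[symmetric]
  by (simp add: prod_cyclotomic_int map_poly_of_int_monom_minus_1)

section \<open>Roots of cyclotomic polynomials\<close>

lemma power_eq_1_iff_cyclotomic_root:
  fixes x :: "'a::field"
  assumes "n > 0"
  shows "x ^ n = 1 \<longleftrightarrow> (\<exists>d. d dvd n \<and> poly (cyclotomic d) x = 0)"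
proof -
  have "poly (\<Prod>d | d dvd n. cyclotomic d) x = x ^ n - 1"
    using assms by (simp add: prod_cyclotomic poly_monom)
  hence "x ^ n = 1 \<longleftrightarrow> (\<Prod>d | d dvd n. poly (cyclotomic d) x) = 0"
    by (simp add: poly_prod)
  also have "\<dots> \<longleftrightarrow> (\<exists>d. d dvd n \<and> poly (cyclotomic d) x = 0)"
    using assms by (subst prod_zero_iff) auto
  finally show ?thesis .
qed

text \<open>This carries the order in the multiplicative group over to powers in the type; an
  element of infinite order has order 0.\<close>

lemma mult_ord_dvd_iff:
  fixes x :: "'a::field"
  assumes "x \<noteq> 0"
  shows "mult_ord x dvd n \<longleftrightarrow> x ^ n = 1"
proof -
  let ?R = "ring_of_type_algebra :: 'a ring"
  interpret R: field ?R by rule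
  \<comment> \<open>\<open>mult_of\<close> resolves to the copy in \<open>Ring_Divisibility\<close>, the library theorem is about the one in
    \<open>Multiplicative_Group\<close>.\<close>
  interpret G: group "mult_of ?R"
    using R.field_mult_group by (simp add: Ring_Divisibility.mult_of_def Multiplicative_Group.mult_of_def)
  have pow: "x [^]\<^bsub>mult_of ?R\<^esub> k = x ^ k" for k :: nat
    by (induction k) (simp_all add: ring_of_type_algebra_def Ring_Divisibility.mult_of_def mult.commute)
  have "x \<in> carrier (mult_of ?R)"
    using assms by (simp add: ring_of_type_algebra_def)
  from G.pow_eq_id[OF this, of n] show ?thesis
    unfolding pow mult_ord_def by (simp add: ring_of_type_algebra_def)
qed

text \<open>If a root had order d < n, it would also be a root of the e-th polynomial for some e
  dividing d, hence a double root of X^n - 1. Conversely, an element of order n is a root for some d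
  dividing n, and then x^d = 1 forces d = n.\<close>

lemma cyclotomic_root_iff_mult_ord:
  fixes x :: "'a::field"
  assumes "x \<noteq> 0" "n > 0" "of_nat n \<noteq> (0 :: 'a)"
  shows "poly (cyclotomic n) x = 0 \<longleftrightarrow> mult_ord x = n"
proof
  assume root: "poly (cyclotomic n) x = 0"
  hence xn: "x ^ n = 1"
    using power_eq_1_iff_cyclotomic_root[OF assms(2), of x] dvd_refl by blast
  define d where "d = mult_ord x"
  have "d dvd n"
    unfolding d_def using mult_ord_dvd_iff[OF assms(1), of n] xn by simp
  moreover have "x ^ d = 1"
    unfolding d_def using mult_ord_dvd_iff[OF assms(1), of "mult_ord x"] by simp
  ultimately have d: "d dvd n" "x ^ d = 1" "d > 0"
    using assms(2) by (auto intro: dvd_pos_nat)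
  show "mult_ord x = n"
  proof (rule ccontr)
    assume "mult_ord x \<noteq> n"
    hence "d < n"
      using d assms by (metis d_def dvd_imp_le le_neq_implies_less)
    obtain e where e: "e dvd d" "poly (cyclotomic e) x = 0"
      using d(2) power_eq_1_iff_cyclotomic_root[OF d(3), of x] by blast
    have "e \<noteq> n" "e dvd n"
      using e d \<open>d < n\<close> by (auto dest: dvd_imp_le intro: dvd_trans)
    have "[:-x, 1:] * [:-x, 1:] dvd cyclotomic n * cyclotomic e"
      using root e by (intro mult_dvd_mono) (simp_all add: poly_eq_0_iff_dvd)
    also have "\<dots> = (\<Prod>d\<in>{n, e}. cyclotomic d)"
      using \<open>e \<noteq> n\<close> by simp
    also have "\<dots> dvd (\<Prod>d | d dvd n. cyclotomic d)"
      using assms \<open>e dvd n\<close> by (intro prod_dvd_prod_subset) auto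
    also have "\<dots> = monom 1 n - 1"
      using assms by (simp add: prod_cyclotomic)
    finally obtain s where s: "monom 1 n - 1 = [:-x, 1:] * ([:-x, 1:] * s)"
      unfolding dvd_def mult.assoc by blast
    have "poly (pderiv (monom 1 n - 1)) x = 0"
      unfolding s by (simp only: pderiv_mult poly_add poly_mult) simp
    thus False
      using assms by (simp add: pderiv_diff pderiv_monom poly_monom)
  qed
next
  assume ord: "mult_ord x = n"
  hence "x ^ n = 1"
    using mult_ord_dvd_iff[of x n] assms by simp
  then obtain d where d: "d dvd n" "poly (cyclotomic d) x = 0"
    using power_eq_1_iff_cyclotomic_root[OF assms(2), of x] by blast
  have "d > 0" using d assms by (auto intro: Nat.gr0I)
  hence "x ^ d = 1"
    using d(2) power_eq_1_iff_cyclotomic_root[of d x] dvd_refl by blast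
  hence "n dvd d"
    using mult_ord_dvd_iff[of x d] assms ord by simp
  thus "poly (cyclotomic n) x = 0"
    using d by (auto dest: dvd_antisym)
qed

section \<open>Lucas atoms\<close>

text \<open>Newton's recurrence for x^k + y^k with B = -(x + y) and C = x y. The start value is
  written \<open>1 + 1\<close> so that additivity and preservation of 1 suffice to map it.\<close>

fun power_sum :: "nat \<Rightarrow> 'a::field poly poly" where
  "power_sum 0 = 1 + 1"
| "power_sum (Suc 0) = - indet_B"
| "power_sum (Suc (Suc k)) = - indet_B * power_sum (Suc k) + (- indet_C) * power_sum k"

text \<open>Represents x^i y^j + x^j y^i: the factor x y is split off until one exponent is 0. For i
  = j the monomial is counted twice.\<close>

fun symmetrized_monom :: "nat \<Rightarrow> nat \<Rightarrow> 'a::field poly poly" where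
  "symmetrized_monom 0 j = power_sum j"
| "symmetrized_monom (Suc i) 0 = power_sum (Suc i)"
| "symmetrized_monom (Suc i) (Suc j) = indet_C * symmetrized_monom i j"

text \<open>An explicit candidate for the atom. Halving the full symmetrised sum avoids a separate
  middle term; in characteristic 2 the factor \<open>1 / 2\<close> would be 0.\<close>

definition lucas_poly :: "nat \<Rightarrow> 'a::field poly poly" where
  "lucas_poly n = [:[:1 / 2:]:] * (\<Sum>i\<le>totient n.
     [:[:coeff (cyclotomic n) i:]:] * symmetrized_monom i (totient n - i))"

lemma power_mult_poly_divide:
  fixes x y :: "'a::field"
  assumes "degree p \<le> m" "y \<noteq> 0"
  shows "y ^ m * poly p (x / y) = (\<Sum>i\<le>m. coeff p i * (x ^ i * y ^ (m - i)))"
proof -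
  have "poly p (x / y) = (\<Sum>i\<le>m. coeff p i * (x / y) ^ i)"
    by (subst (1) poly_as_sum_of_monoms'[OF assms(1), symmetric]) (simp add: poly_sum poly_monom)
  thus ?thesis
    using assms(2) by (auto simp: sum_distrib_left power_diff power_divide field_simps intro!: sum.cong)
qed

section \<open>Specialisation of B and C\<close>

text \<open>One computation serves two homomorphisms: the embedding into the algebraic closure of
  the rational function field, and evaluation at (b, c).\<close>

locale symmetric_specialization =
  fixes \<phi> :: "'a::field poly poly \<Rightarrow> 'k::field" and x y :: 'k
  assumes hom_add: "\<phi> (P + Q) = \<phi> P + \<phi> Q"
    and hom_mult: "\<phi> (P * Q) = \<phi> P * \<phi> Q"
    and hom_1: "\<phi> 1 = 1"
    and hom_B: "\<phi> indet_B = - (x + y)"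
    and hom_C: "\<phi> indet_C = x * y"
begin

lemma hom_0: "\<phi> 0 = 0"
  using hom_add[of 0 0] by (simp only: add_0_right add_cancel_right_right)

lemma hom_minus: "\<phi> (- P) = - \<phi> P"
  using hom_add[of P "- P"] hom_0 by (simp add: eq_neg_iff_add_eq_0 add.commute)

lemma hom_sum: "\<phi> (sum f A) = (\<Sum>a\<in>A. \<phi> (f a))"
  by (induction A rule: infinite_finite_induct) (auto simp: hom_0 hom_add)

lemma hom_power_sum: "\<phi> (power_sum k) = x ^ k + y ^ k"
proof (induction k rule: power_sum.induct)
  case (3 k)
  have "\<phi> (power_sum (Suc (Suc k))) = (x + y) * (x ^ Suc k + y ^ Suc k) - x * y * (x ^ k + y ^ k)"
    by (simp only: power_sum.simps hom_add hom_mult hom_minus hom_B hom_C 3) simp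
  thus ?case
    by (simp add: algebra_simps)
next
  case 1
  show ?case
    by (simp only: power_sum.simps hom_add hom_1 power_0)
next
  case 2
  show ?case
    by (simp add: hom_minus hom_B)
qed

lemma hom_symmetrized_monom: "\<phi> (symmetrized_monom i j) = x ^ i * y ^ j + x ^ j * y ^ i"
  by (induction i j rule: symmetrized_monom.induct)
     (simp_all add: hom_power_sum hom_mult hom_C algebra_simps)

lemma hom_lucas_poly:
  assumes "n \<ge> 2" "y \<noteq> 0" "(2 :: 'a) \<noteq> 0"
  shows "\<phi> (lucas_poly n) =
    y ^ totient n * poly (map_poly (\<lambda>a. \<phi> [:[:a:]:]) (cyclotomic n)) (x / y)"
proof -
  let ?m = "totient n"
  let ?h = "\<lambda>a. \<phi> [:[:a:]:]"
  let ?p = "map_poly ?h (cyclotomic n)"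
  have coeff: "coeff ?p i = ?h (coeff (cyclotomic n) i)" for i
    by (simp add: coeff_map_poly hom_0)
  have deg: "degree ?p \<le> ?m"
    using map_poly_degree_leq degree_cyclotomic_le assms by (metis le_trans less_le_trans pos2)
  define S where "S = (\<Sum>i\<le>?m. coeff ?p i * (x ^ i * y ^ (?m - i)))"
  have S: "S = y ^ ?m * poly ?p (x / y)"
    unfolding S_def by (rule power_mult_poly_divide[symmetric]) (use deg assms in auto)
  \<comment> \<open>Palindromicity enters here: reversing the index exchanges x and y, so the
    symmetrised sum is \<open>S + S\<close>.\<close>
  have "(\<Sum>i\<le>?m. coeff ?p i * (x ^ (?m - i) * y ^ i)) = S"
    unfolding S_def
    by (rule sum.reindex_bij_witness[where i = "\<lambda>i. ?m - i" and j = "\<lambda>i. ?m - i"])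
       (use assms in \<open>auto simp: coeff coeff_cyclotomic_reflect\<close>)
  hence "\<phi> (\<Sum>i\<le>?m. [:[:coeff (cyclotomic n) i:]:] * symmetrized_monom i (?m - i)) = S + S"
    by (simp add: hom_sum hom_mult hom_symmetrized_monom coeff distrib_left sum.distrib S_def
        del: mult_pCons_left)
  hence "\<phi> (lucas_poly n) = ?h (1 / 2) * (S + S)"
    by (simp only: lucas_poly_def hom_mult)
  also have "\<dots> = (?h (1 / 2) + ?h (1 / 2)) * S"
    by (simp add: algebra_simps)
  also have "?h (1 / 2) + ?h (1 / 2) = \<phi> ([:[:1 / 2:]:] + [:[:1 / 2:]:])"
    by (simp only: hom_add)
  also have "1 / 2 + 1 / 2 = (1 :: 'a)"
    using assms(3) by (simp flip: mult_2)
  hence "[:[:1 / 2:]:] + [:[:1 / 2:]:] = (1 :: 'a poly poly)"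
    by (simp add: one_pCons)
  finally show ?thesis
    by (simp add: S hom_1)
qed

end

section \<open>Identification of the atom and the equivalence\<close>

lemma monic_quadratic_eq_prod_iff:
  fixes x y :: "'a::comm_ring_1"
  shows "[:c, b, 1:] = [:-x, 1:] * [:-y, 1:] \<longleftrightarrow> b = - (x + y) \<and> c = x * y"
  by auto

text \<open>The candidate satisfies the defining condition for every ordering of the roots, and
  \<open>BC_to_ac\<close> is injective, so no other polynomial does.\<close>

lemma lucas_atom_eq_lucas_poly:
  assumes "n \<ge> 2" "(2 :: 'a) \<noteq> 0"
  shows "lucas_atom n = (lucas_poly n :: 'a::field poly poly)"
proof -
  let ?roots = "\<lambda>\<alpha> \<beta> :: 'a poly poly fract alg_closure. [:BC_to_ac indet_C, BC_to_ac indet_B, 1:] = [:-\<alpha>, 1:] * [:-\<beta>, 1:]"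
  have eq: "BC_to_ac (lucas_poly n :: 'a poly poly) = cyclotomic_hom n \<alpha> \<beta>" if r: "?roots \<alpha> \<beta>" for \<alpha> \<beta>
  proof -
    interpret symmetric_specialization BC_to_ac \<alpha> \<beta>
      by unfold_locales
         (use r in \<open>simp_all add: BC_to_ac_def monic_quadratic_eq_prod_iff del: mult_pCons_left mult_pCons_right\<close>)
    have "BC_to_ac (indet_C :: 'a poly poly) \<noteq> 0"
      by (simp add: BC_to_ac_def indet_C_def)
    hence "\<beta> \<noteq> 0"
      using hom_C by auto
    thus ?thesis
      using hom_lucas_poly[OF assms(1) _ assms(2)] by (simp add: cyclotomic_hom_def)
  qed
  \<comment> \<open>Without a factorisation the condition on \<open>L\<close> would be vacuous and
    uniqueness would fail. The second root comes from the first by Vieta.\<close>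
  have ex: "\<exists>\<alpha> \<beta>. ?roots \<alpha> \<beta>"
  proof -
    let ?f = "[:BC_to_ac indet_C, BC_to_ac indet_B, 1:] :: 'a poly poly fract alg_closure poly"
    obtain \<alpha> where "poly ?f \<alpha> = 0"
      using alg_closed_imp_poly_has_root[of ?f] by auto
    hence "BC_to_ac indet_C = \<alpha> * (- BC_to_ac indet_B - \<alpha>)"
      by (simp add: algebra_simps eq_neg_iff_add_eq_0)
    hence "?roots \<alpha> (- BC_to_ac indet_B - \<alpha>)"
      unfolding monic_quadratic_eq_prod_iff by simp
    thus ?thesis by blast
  qed
  have "(THE L :: 'a poly poly. \<forall>\<alpha> \<beta>. ?roots \<alpha> \<beta> \<longrightarrow> BC_to_ac L = cyclotomic_hom n \<alpha> \<beta>) = lucas_poly n"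
  proof (rule the_equality)
    show "\<forall>\<alpha> \<beta>. ?roots \<alpha> \<beta> \<longrightarrow> BC_to_ac (lucas_poly n) = cyclotomic_hom n \<alpha> \<beta>"
      using eq by blast
    fix L assume "\<forall>\<alpha> \<beta>. ?roots \<alpha> \<beta> \<longrightarrow> BC_to_ac L = cyclotomic_hom n \<alpha> \<beta>"
    with ex eq have "BC_to_ac L = BC_to_ac (lucas_poly n)"
      by metis
    thus "L = lucas_poly n"
      by (simp add: BC_to_ac_def)
  qed
  thus ?thesis
    using assms by (simp add: lucas_atom_def)
qed

lemma of_nat_neq_0_if_coprime_CARD:
  assumes "coprime n CARD('a::{field, finite})"
  shows "of_nat n \<noteq> (0 :: 'a)"
proof
  assume "of_nat n = (0 :: 'a)"
  hence "CHAR('a) dvd n"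
    by (simp add: of_nat_eq_0_iff_char_dvd)
  hence "is_unit CHAR('a)"
    using assms CHAR_dvd_CARD[where 'a = 'a] by (meson coprime_common_divisor)
  hence "CHAR('a) = 1" by simp
  thus False by simp
qed

text \<open>For n = 1 and a double root the equivalence fails: the atom is the constant 1 while the
  ratio of the roots has order 1. The last hypothesis excludes exactly this case.\<close>

theorem lemma5p1:
  fixes b c :: "'a :: {field, finite}"
    and \<theta>\<^sub>1 \<theta>\<^sub>2 :: "'a alg_closure"
    and q n :: nat
  assumes "q = CARD('a)" and "odd q"
    and "c \<noteq> 0"
    and "map_poly to_ac [:c, b, 1:] = [:-\<theta>\<^sub>1, 1:] * [:-\<theta>\<^sub>2, 1:]"
    and "n > 0" and "coprime n q"
    and "n = 1 \<longrightarrow> \<theta>\<^sub>1 \<noteq> \<theta>\<^sub>2"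
  shows "eval_BC (lucas_atom n) b c = 0 \<longleftrightarrow> mult_ord (\<theta>\<^sub>1 / \<theta>\<^sub>2) = n"
proof -
  have "[:to_ac c, to_ac b, 1:] = [:-\<theta>\<^sub>1, 1:] * [:-\<theta>\<^sub>2, 1:]"
    using assms(4) by (simp add: map_poly_pCons del: mult_pCons_left mult_pCons_right)
  hence bc: "to_ac b = - (\<theta>\<^sub>1 + \<theta>\<^sub>2)" "to_ac c = \<theta>\<^sub>1 * \<theta>\<^sub>2"
    unfolding monic_quadratic_eq_prod_iff by auto
  have nz: "\<theta>\<^sub>1 \<noteq> 0" "\<theta>\<^sub>2 \<noteq> 0"
    using bc(2) \<open>c \<noteq> 0\<close> by (metis mult_eq_0_iff to_ac_eq_0_iff)+
  show ?thesis
  proof (cases "n = 1")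
    case True
    have "\<theta>\<^sub>1 / \<theta>\<^sub>2 \<noteq> 1"
      using assms True nz by simp
    hence "mult_ord (\<theta>\<^sub>1 / \<theta>\<^sub>2) \<noteq> 1"
      using mult_ord_dvd_iff[of "\<theta>\<^sub>1 / \<theta>\<^sub>2" 1] nz by auto
    thus ?thesis
      using True by (simp add: lucas_atom_def eval_BC_def)
  next
    case False
    hence n: "n \<ge> 2" using assms by simp
    have 2: "(2 :: 'a) \<noteq> 0"
      using of_nat_neq_0_if_coprime_CARD[of 2, where 'a = 'a] assms by (simp add: coprime_left_2_iff_odd)
    have "of_nat n \<noteq> (0 :: 'a)"
      using assms by (intro of_nat_neq_0_if_coprime_CARD) simp
    hence n0: "of_nat n \<noteq> (0 :: 'a alg_closure)"
      by (metis to_ac_of_nat to_ac_eq_0_iff)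
    interpret symmetric_specialization "\<lambda>P. to_ac (eval_BC P b c)" \<theta>\<^sub>1 \<theta>\<^sub>2
      by unfold_locales (use bc in \<open>simp_all add: eval_BC_def indet_B_def indet_C_def\<close>)
    \<comment> \<open>The coefficients are images of integers, so base change to the closure yields
      the cyclotomic polynomial there.\<close>
    have "map_poly (\<lambda>a. to_ac (eval_BC [:[:a:]:] b c)) (cyclotomic n) = cyclotomic n"
      by (rule poly_eqI) (simp add: cyclotomic_def coeff_map_poly eval_BC_def)
    hence "to_ac (eval_BC (lucas_atom n) b c) = \<theta>\<^sub>2 ^ totient n * poly (cyclotomic n) (\<theta>\<^sub>1 / \<theta>\<^sub>2)"
      using hom_lucas_poly[OF n nz(2) 2] lucas_atom_eq_lucas_poly[OF n 2] by simp
    hence "eval_BC (lucas_atom n) b c = 0 \<longleftrightarrow> poly (cyclotomic n) (\<theta>\<^sub>1 / \<theta>\<^sub>2) = 0"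
      using nz by (metis mult_eq_0_iff power_not_zero to_ac_eq_0_iff)
    also have "\<dots> \<longleftrightarrow> mult_ord (\<theta>\<^sub>1 / \<theta>\<^sub>2) = n"
      by (rule cyclotomic_root_iff_mult_ord) (use nz n0 assms in auto)
    finally show ?thesis .
  qed
qed

end
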